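(* Let $e\colon\Sigma\to PC$ be an estimate consensus protocol in a topos $\mathcal E$. Inconsistent propositions are not safe at related states: if $p,q\colon1\to PC$ are propositions with $p\wedge q=\bot$, and $w_1\colon W_1\to\Sigma_0$ and $w_2\colon W_2\to\Sigma_0$ are compatible states ($w_1\simeq w_2$), then it is not the case that both $w_1\Vdash(x\Rightarrow p)$ and $w_2\Vdash(x\Rightarrow q)$ hold.
   Context: Let $\mathcal E$ be a topos with subobject classifier $\top\colon1\to\Omega$; $\top_X\colon X\to1\to\Omega$. For an object $C$, the power object $PC$ is an internal Heyting algebra with order $(\leq)\to PC\times PC$. For $s,t\colon X\to PC$, write $s\Rightarrow t\colon X\to\Omega$ for the composite of $\langle s,t\rangle$ with the classifying map $PC\times PC\to\Omega$ of $(\leq)$; "$s\Rightarrow t=\top$" means it equals $\top_X$. A global element $p\colon1\to PC$ (a proposition) is viewed as defined on $X$ via $X\to1$; $\neg p\colon1\to PC$ is its pseudocomplement, and $\bot$ the bottom global element. An estimate consensus protocol in $\mathcal E$ consists of an object $C$, an internal category $\Sigma$ (objects $\Sigma_0$, arrows $\Sigma_1$, domain $d_0$ and codomain $d_1$), and an internal functor $e\colon\Sigma\to PC$ (with object part $e_0$; $PC$ an internal poset) such that for every $w\colon X\to\Sigma_0$ and $p\colon1\to PC$: if $e_0w\Rightarrow p=\top$ then $\neg(e_0w\Rightarrow\neg p)=\top$, where the outer $\neg$ is negation on $\Omega$. A state is a morphism $w\colon W\to\Sigma_0$. An execution $f\colon w\to v$ on $w$ is a morphism $f\colon X\to\Sigma_1$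 together with an epimorphism $r\colon X\to W$ such that $d_0f=wr$; its target is the state $v=d_1f\colon X\to\Sigma_0$. States $w_1,w_2$ are compatible, $w_1\simeq w_2$, if there are a state $w_3\colon X\to\Sigma_0$ and executions $w_1\to w_3\leftarrow w_2$. $\Sigma(w,-)$ is the pullback of $w$ and $d_0$, with second projection $\pi_2\colon\Sigma(w,-)\to\Sigma_1$. The notation $w\Vdash(x\Rightarrow p)$ means that the composite $e_0d_1\pi_2\Rightarrow p\colon\Sigma(w,-)\to\Omega$ equals $\top_{\Sigma(w,-)}$; it expresses that $p$ is safe in $w$, i.e. that $e_0v\Rightarrow p=\top$ for every execution $f\colon w\to v$ on $w$.
   Formalization: The formal statement adds the hypothesis that W_1 is not an initial object; over an initial W_1 every proposition is vacuously safe at both compatible states, so the claim as written fails there. *)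

theory Defs
  imports Main
begin

section \<open>Categories\<close>

text \<open>\<open>g \<cdot> f\<close> is ``\<open>g\<close> after \<open>f\<close>''. Outside \<open>Obj\<close> and \<open>Arr\<close>, and on arrows
  that are not composable, the operations are unconstrained.\<close>

record ('o, 'a) precat =
  Obj :: "'o set"
  Arr :: "'a set"
  Dom :: "'a \<Rightarrow> 'o"
  Cod :: "'a \<Rightarrow> 'o"
  Ident :: "'o \<Rightarrow> 'a"
  Compose :: "'a \<Rightarrow> 'a \<Rightarrow> 'a"  (infixr \<open>\<cdot>\<index>\<close> 70)

definition hom :: "('o, 'a, 'm) precat_scheme \<Rightarrow> 'o \<Rightarrow> 'o \<Rightarrow> 'a set"
  where "hom E A B = {f \<in> Arr E. Dom E f = A \<and> Cod E f = B}"

locale category =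
  fixes E :: "('o, 'a, 'm) precat_scheme" (structure)
  assumes dom_obj: "f \<in> Arr E \<Longrightarrow> Dom E f \<in> Obj E"
    and cod_obj: "f \<in> Arr E \<Longrightarrow> Cod E f \<in> Obj E"
    and ident_hom: "A \<in> Obj E \<Longrightarrow> Ident E A \<in> hom E A A"
    and compose_hom: "\<lbrakk>f \<in> hom E A B; g \<in> hom E B D\<rbrakk> \<Longrightarrow> g \<cdot> f \<in> hom E A D"
    and compose_ident: "f \<in> hom E A B \<Longrightarrow> f \<cdot> Ident E A = f"
    and ident_compose: "f \<in> hom E A B \<Longrightarrow> Ident E B \<cdot> f = f"
    and compose_assoc:
      "\<lbrakk>f \<in> hom E A B; g \<in> hom E B D; h \<in> hom E D F\<rbrakk> \<Longrightarrow> (h \<cdot> g) \<cdot> f = h \<cdot> (g \<cdot> f)"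

definition terminal :: "('o, 'a, 'm) precat_scheme \<Rightarrow> 'o \<Rightarrow> bool"
  where "terminal E T \<longleftrightarrow> T \<in> Obj E \<and> (\<forall>X\<in>Obj E. \<exists>!f. f \<in> hom E X T)"

definition initial :: "('o, 'a, 'm) precat_scheme \<Rightarrow> 'o \<Rightarrow> bool"
  where "initial E Z \<longleftrightarrow> Z \<in> Obj E \<and> (\<forall>X\<in>Obj E. \<exists>!f. f \<in> hom E Z X)"

definition monic :: "('o, 'a, 'm) precat_scheme \<Rightarrow> 'a \<Rightarrow> bool"
  where "monic E m \<longleftrightarrow> m \<in> Arr E \<and>
    (\<forall>X. \<forall>g\<in>hom E X (Dom E m). \<forall>h\<in>hom E X (Dom E m).
      m \<cdot>\<^bsub>E\<^esub> g = m \<cdot>\<^bsub>E\<^esub> h \<longrightarrow> g = h)"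

definition epic :: "('o, 'a, 'm) precat_scheme \<Rightarrow> 'a \<Rightarrow> bool"
  where "epic E r \<longleftrightarrow> r \<in> Arr E \<and>
    (\<forall>Y. \<forall>g\<in>hom E (Cod E r) Y. \<forall>h\<in>hom E (Cod E r) Y.
      g \<cdot>\<^bsub>E\<^esub> r = h \<cdot>\<^bsub>E\<^esub> r \<longrightarrow> g = h)"

definition is_product ::
    "('o, 'a, 'm) precat_scheme \<Rightarrow> 'o \<Rightarrow> 'o \<Rightarrow> 'o \<Rightarrow> 'a \<Rightarrow> 'a \<Rightarrow> bool"
  where "is_product E A B P p q \<longleftrightarrow> p \<in> hom E P A \<and> q \<in> hom E P B \<and>
    (\<forall>X. \<forall>f\<in>hom E X A. \<forall>g\<in>hom E X B.
      \<exists>!u. u \<in> hom E X P \<and> p \<cdot>\<^bsub>E\<^esub> u = f \<and> q \<cdot>\<^bsub>E\<^esub> u = g)"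

definition is_equalizer ::
    "('o, 'a, 'm) precat_scheme \<Rightarrow> 'a \<Rightarrow> 'a \<Rightarrow> 'a \<Rightarrow> bool"
  where "is_equalizer E f g e \<longleftrightarrow> e \<in> hom E (Dom E e) (Dom E f) \<and>
    f \<cdot>\<^bsub>E\<^esub> e = g \<cdot>\<^bsub>E\<^esub> e \<and>
    (\<forall>X. \<forall>h\<in>hom E X (Dom E f). f \<cdot>\<^bsub>E\<^esub> h = g \<cdot>\<^bsub>E\<^esub> h \<longrightarrow>
      (\<exists>!u. u \<in> hom E X (Dom E e) \<and> e \<cdot>\<^bsub>E\<^esub> u = h))"

text \<open>The square with sides \<open>p, q\<close> out of the vertex and \<open>f, g\<close> into the common codomain,
  \<open>f \<cdot> p = g \<cdot> q\<close>.\<close>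

definition is_pullback ::
    "('o, 'a, 'm) precat_scheme \<Rightarrow> 'a \<Rightarrow> 'a \<Rightarrow> 'a \<Rightarrow> 'a \<Rightarrow> bool"
  where "is_pullback E f g p q \<longleftrightarrow>
    p \<in> hom E (Dom E p) (Dom E f) \<and> q \<in> hom E (Dom E p) (Dom E g) \<and>
    f \<cdot>\<^bsub>E\<^esub> p = g \<cdot>\<^bsub>E\<^esub> q \<and>
    (\<forall>X. \<forall>h\<in>hom E X (Dom E f). \<forall>k\<in>hom E X (Dom E g).
      f \<cdot>\<^bsub>E\<^esub> h = g \<cdot>\<^bsub>E\<^esub> k \<longrightarrow>
      (\<exists>!u. u \<in> hom E X (Dom E p) \<and> p \<cdot>\<^bsub>E\<^esub> u = h \<and> q \<cdot>\<^bsub>E\<^esub> u = k))"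


section \<open>Elementary toposes\<close>

text \<open>A topos is presented with a choice of terminal object, binary products, equalizers
  (given by the equalizing arrow), exponentials and subobject classifier. \<open>Exp C B\<close> is
  \<open>B\<^sup>C\<close>, with evaluation \<open>Ev C B : C \<times> B\<^sup>C \<rightarrow> B\<close>.\<close>

record ('o, 'a) topos_data = "('o, 'a) precat" +
  One :: 'o
  Prod :: "'o \<Rightarrow> 'o \<Rightarrow> 'o"
  Fst :: "'o \<Rightarrow> 'o \<Rightarrow> 'a"
  Snd :: "'o \<Rightarrow> 'o \<Rightarrow> 'a"
  Eq :: "'a \<Rightarrow> 'a \<Rightarrow> 'a"
  Exp :: "'o \<Rightarrow> 'o \<Rightarrow> 'o"
  Ev :: "'o \<Rightarrow> 'o \<Rightarrow> 'a"
  Omega :: 'o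
  Truth :: 'a

definition bang :: "('o, 'a, 'm) topos_data_scheme \<Rightarrow> 'o \<Rightarrow> 'a"
  where "bang E X = (THE f. f \<in> hom E X (One E))"

definition pair :: "('o, 'a, 'm) topos_data_scheme \<Rightarrow> 'a \<Rightarrow> 'a \<Rightarrow> 'a"
  where "pair E f g = (THE u. u \<in> hom E (Dom E f) (Prod E (Cod E f) (Cod E g)) \<and>
    Fst E (Cod E f) (Cod E g) \<cdot>\<^bsub>E\<^esub> u = f \<and> Snd E (Cod E f) (Cod E g) \<cdot>\<^bsub>E\<^esub> u = g)"

definition cross :: "('o, 'a, 'm) topos_data_scheme \<Rightarrow> 'a \<Rightarrow> 'a \<Rightarrow> 'a"
  where "cross E f g = pair E
    (f \<cdot>\<^bsub>E\<^esub> Fst E (Dom E f) (Dom E g)) (g \<cdot>\<^bsub>E\<^esub> Snd E (Dom E f) (Dom E g))"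

locale elementary_topos = category E
  for E :: "('o, 'a, 'm) topos_data_scheme" (structure) +
  assumes one_terminal: "terminal E (One E)"
    and prod_product: "\<lbrakk>A \<in> Obj E; B \<in> Obj E\<rbrakk>
      \<Longrightarrow> is_product E A B (Prod E A B) (Fst E A B) (Snd E A B)"
    and eq_equalizer: "\<lbrakk>f \<in> hom E A B; g \<in> hom E A B\<rbrakk> \<Longrightarrow> is_equalizer E f g (Eq E f g)"
    and exp_obj: "\<lbrakk>C \<in> Obj E; B \<in> Obj E\<rbrakk> \<Longrightarrow> Exp E C B \<in> Obj E"
    and ev_hom: "\<lbrakk>C \<in> Obj E; B \<in> Obj E\<rbrakk> \<Longrightarrow> Ev E C B \<in> hom E (Prod E C (Exp E C B)) B"
    and ev_universal: "\<lbrakk>C \<in> Obj E; B \<in> Obj E; X \<in> Obj E; f \<in> hom E (Prod E C X) B\<rbrakk>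
      \<Longrightarrow> \<exists>!u. u \<in> hom E X (Exp E C B) \<and> Ev E C B \<cdot> cross E (Ident E C) u = f"
    and truth_hom: "Truth E \<in> hom E (One E) (Omega E)"
    and truth_classifies: "monic E m
      \<Longrightarrow> \<exists>!c. c \<in> hom E (Cod E m) (Omega E) \<and> is_pullback E c (Truth E) m (bang E (Dom E m))"

text \<open>The pullback of \<open>f\<close> and \<open>g\<close>, constructed as the equalizer of \<open>f \<cdot> \<pi>\<^sub>1\<close> and \<open>g \<cdot> \<pi>\<^sub>2\<close>.
  \<open>pb_pair E f g h k\<close> is the arrow into it induced by \<open>h\<close> and \<open>k\<close>.\<close>

definition pb_arr :: "('o, 'a, 'm) topos_data_scheme \<Rightarrow> 'a \<Rightarrow> 'a \<Rightarrow> 'a"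
  where "pb_arr E f g = Eq E
    (f \<cdot>\<^bsub>E\<^esub> Fst E (Dom E f) (Dom E g)) (g \<cdot>\<^bsub>E\<^esub> Snd E (Dom E f) (Dom E g))"

definition pb_obj :: "('o, 'a, 'm) topos_data_scheme \<Rightarrow> 'a \<Rightarrow> 'a \<Rightarrow> 'o"
  where "pb_obj E f g = Dom E (pb_arr E f g)"

definition pb1 :: "('o, 'a, 'm) topos_data_scheme \<Rightarrow> 'a \<Rightarrow> 'a \<Rightarrow> 'a"
  where "pb1 E f g = Fst E (Dom E f) (Dom E g) \<cdot>\<^bsub>E\<^esub> pb_arr E f g"

definition pb2 :: "('o, 'a, 'm) topos_data_scheme \<Rightarrow> 'a \<Rightarrow> 'a \<Rightarrow> 'a"
  where "pb2 E f g = Snd E (Dom E f) (Dom E g) \<cdot>\<^bsub>E\<^esub> pb_arr E f g"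

definition pb_pair :: "('o, 'a, 'm) topos_data_scheme \<Rightarrow> 'a \<Rightarrow> 'a \<Rightarrow> 'a \<Rightarrow> 'a \<Rightarrow> 'a"
  where "pb_pair E f g h k = (THE u. u \<in> hom E (Dom E h) (pb_obj E f g) \<and>
    pb1 E f g \<cdot>\<^bsub>E\<^esub> u = h \<and> pb2 E f g \<cdot>\<^bsub>E\<^esub> u = k)"

text \<open>Transpose \<open>X \<rightarrow> B\<^sup>C\<close> of \<open>f : C \<times> X \<rightarrow> B\<close>; \<open>X\<close> cannot be recovered from \<open>f\<close>.\<close>

definition curry_arr :: "('o, 'a, 'm) topos_data_scheme \<Rightarrow> 'o \<Rightarrow> 'o \<Rightarrow> 'a \<Rightarrow> 'a"
  where "curry_arr E C X f = (THE u. u \<in> hom E X (Exp E C (Cod E f)) \<and>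
    Ev E C (Cod E f) \<cdot>\<^bsub>E\<^esub> cross E (Ident E C) u = f)"

definition char_arr :: "('o, 'a, 'm) topos_data_scheme \<Rightarrow> 'a \<Rightarrow> 'a"
  where "char_arr E m = (THE c. c \<in> hom E (Cod E m) (Omega E) \<and>
    is_pullback E c (Truth E) m (bang E (Dom E m)))"

definition truth_on :: "('o, 'a, 'm) topos_data_scheme \<Rightarrow> 'o \<Rightarrow> 'a"
  where "truth_on E X = Truth E \<cdot>\<^bsub>E\<^esub> bang E X"

text \<open>\<open>\<and> : \<Omega> \<times> \<Omega> \<rightarrow> \<Omega>\<close> classifies \<open>\<langle>\<top>, \<top>\<rangle> : 1 \<rightarrow> \<Omega> \<times> \<Omega>\<close>; false classifies \<open>0 \<rightarrow> 1\<close>;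
  and \<open>\<not> : \<Omega> \<rightarrow> \<Omega>\<close> classifies false. No initial object is chosen in the data, but false does
  not depend on the choice.\<close>

definition and_Omega :: "('o, 'a, 'm) topos_data_scheme \<Rightarrow> 'a"
  where "and_Omega E = char_arr E (pair E (Truth E) (Truth E))"

definition false_Omega :: "('o, 'a, 'm) topos_data_scheme \<Rightarrow> 'a"
  where "false_Omega E = (THE b. \<exists>Z. initial E Z \<and> b = char_arr E (bang E Z))"

definition not_Omega :: "('o, 'a, 'm) topos_data_scheme \<Rightarrow> 'a"
  where "not_Omega E = char_arr E (false_Omega E)"


section \<open>Power objects as internal Heyting algebras\<close>

definition Pow_obj :: "('o, 'a, 'm) topos_data_scheme \<Rightarrow> 'o \<Rightarrow> 'o"
  where "Pow_obj E C = Exp E C (Omega E)"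

text \<open>\<open>\<and> : PC \<times> PC \<rightarrow> PC\<close> is the transpose of the map
  \<open>(c, S, T) \<mapsto> (c \<in> S) \<and> (c \<in> T)\<close> from \<open>C \<times> (PC \<times> PC)\<close> to \<open>\<Omega>\<close>.\<close>

definition and_Pow :: "('o, 'a, 'm) topos_data_scheme \<Rightarrow> 'o \<Rightarrow> 'a"
  where "and_Pow E C =
    (let PC = Pow_obj E C; mem = Ev E C (Omega E) in
      curry_arr E C (Prod E PC PC)
        (and_Omega E \<cdot>\<^bsub>E\<^esub> pair E
          (mem \<cdot>\<^bsub>E\<^esub> cross E (Ident E C) (Fst E PC PC))
          (mem \<cdot>\<^bsub>E\<^esub> cross E (Ident E C) (Snd E PC PC))))"

text \<open>The order \<open>(\<le>) \<rightarrow> PC \<times> PC\<close>, i.e. the pairs \<open>(S, T)\<close> with \<open>S \<and> T = S\<close>, as an arrow.\<close>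

definition le_Pow :: "('o, 'a, 'm) topos_data_scheme \<Rightarrow> 'o \<Rightarrow> 'a"
  where "le_Pow E C = Eq E (and_Pow E C) (Fst E (Pow_obj E C) (Pow_obj E C))"

text \<open>\<open>s \<Rightarrow> t : X \<rightarrow> \<Omega>\<close> for \<open>s, t : X \<rightarrow> PC\<close>.\<close>

definition imp :: "('o, 'a, 'm) topos_data_scheme \<Rightarrow> 'o \<Rightarrow> 'a \<Rightarrow> 'a \<Rightarrow> 'a"
  where "imp E C s t = char_arr E (le_Pow E C) \<cdot>\<^bsub>E\<^esub> pair E s t"

definition meet :: "('o, 'a, 'm) topos_data_scheme \<Rightarrow> 'o \<Rightarrow> 'a \<Rightarrow> 'a \<Rightarrow> 'a"
  where "meet E C s t = and_Pow E C \<cdot>\<^bsub>E\<^esub> pair E s t"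

definition propositions :: "('o, 'a, 'm) topos_data_scheme \<Rightarrow> 'o \<Rightarrow> 'a set"
  where "propositions E C = hom E (One E) (Pow_obj E C)"

definition prop_on :: "('o, 'a, 'm) topos_data_scheme \<Rightarrow> 'a \<Rightarrow> 'o \<Rightarrow> 'a"
  where "prop_on E p X = p \<cdot>\<^bsub>E\<^esub> bang E X"

text \<open>Bottom and pseudocomplements are those of the internal Heyting algebra \<open>PC\<close>, hence
  characterised against all generalized elements \<open>t : X \<rightarrow> PC\<close>; the order is antisymmetric,
  so they are unique.\<close>

definition bot_Pow :: "('o, 'a, 'm) topos_data_scheme \<Rightarrow> 'o \<Rightarrow> 'a"
  where "bot_Pow E C = (THE b. b \<in> propositions E C \<and>
    (\<forall>X. \<forall>t\<in>hom E X (Pow_obj E C). imp E C (prop_on E b X) t = truth_on E X))"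

definition neg_Pow :: "('o, 'a, 'm) topos_data_scheme \<Rightarrow> 'o \<Rightarrow> 'a \<Rightarrow> 'a"
  where "neg_Pow E C p = (THE n. n \<in> propositions E C \<and>
    (\<forall>X. \<forall>t\<in>hom E X (Pow_obj E C).
      imp E C t (prop_on E n X) = truth_on E X \<longleftrightarrow> meet E C t (prop_on E p X) = prop_on E (bot_Pow E C) X))"


section \<open>Internal categories and functors\<close>

text \<open>The composition arrow is defined on the pullback of \<open>d1\<close> and \<open>d0\<close>, so that it takes
  \<open>(f, g)\<close> with \<open>d1 f = d0 g\<close> to ``first \<open>f\<close>, then \<open>g\<close>''.\<close>

record ('o, 'a) icat =
  obs :: 'o
  arrs :: 'o
  d0 :: 'a
  d1 :: 'a
  idt :: 'a
  cmp :: 'a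

text \<open>The unit and associativity laws are stated on generalized elements.\<close>

locale internal_category = elementary_topos E
  for E :: "('o, 'a, 'm) topos_data_scheme" (structure) and S :: "('o, 'a) icat" +
  assumes d0_hom: "d0 S \<in> hom E (arrs S) (obs S)"
    and d1_hom: "d1 S \<in> hom E (arrs S) (obs S)"
    and idt_hom: "idt S \<in> hom E (obs S) (arrs S)"
    and cmp_hom: "cmp S \<in> hom E (pb_obj E (d1 S) (d0 S)) (arrs S)"
    and d0_idt: "d0 S \<cdot> idt S = Ident E (obs S)"
    and d1_idt: "d1 S \<cdot> idt S = Ident E (obs S)"
    and d0_cmp: "d0 S \<cdot> cmp S = d0 S \<cdot> pb1 E (d1 S) (d0 S)"
    and d1_cmp: "d1 S \<cdot> cmp S = d1 S \<cdot> pb2 E (d1 S) (d0 S)"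
    and cmp_idt_left: "f \<in> hom E X (arrs S)
      \<Longrightarrow> cmp S \<cdot> pb_pair E (d1 S) (d0 S) (idt S \<cdot> d0 S \<cdot> f) f = f"
    and cmp_idt_right: "f \<in> hom E X (arrs S)
      \<Longrightarrow> cmp S \<cdot> pb_pair E (d1 S) (d0 S) f (idt S \<cdot> d1 S \<cdot> f) = f"
    and cmp_assoc: "\<lbrakk>f \<in> hom E X (arrs S); g \<in> hom E X (arrs S); h \<in> hom E X (arrs S);
        d1 S \<cdot> f = d0 S \<cdot> g; d1 S \<cdot> g = d0 S \<cdot> h\<rbrakk>
      \<Longrightarrow> cmp S \<cdot> pb_pair E (d1 S) (d0 S) (cmp S \<cdot> pb_pair E (d1 S) (d0 S) f g) h =
          cmp S \<cdot> pb_pair E (d1 S) (d0 S) f (cmp S \<cdot> pb_pair E (d1 S) (d0 S) g h)"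

definition internal_functor ::
    "('o, 'a, 'm) topos_data_scheme \<Rightarrow> ('o, 'a) icat \<Rightarrow> ('o, 'a) icat \<Rightarrow> 'a \<Rightarrow> 'a \<Rightarrow> bool"
  where "internal_functor E S T F0 F1 \<longleftrightarrow>
    F0 \<in> hom E (obs S) (obs T) \<and> F1 \<in> hom E (arrs S) (arrs T) \<and>
    d0 T \<cdot>\<^bsub>E\<^esub> F1 = F0 \<cdot>\<^bsub>E\<^esub> d0 S \<and> d1 T \<cdot>\<^bsub>E\<^esub> F1 = F0 \<cdot>\<^bsub>E\<^esub> d1 S \<and>
    F1 \<cdot>\<^bsub>E\<^esub> idt S = idt T \<cdot>\<^bsub>E\<^esub> F0 \<and>
    F1 \<cdot>\<^bsub>E\<^esub> cmp S = cmp T \<cdot>\<^bsub>E\<^esub> pb_pair E (d1 T) (d0 T)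
      (F1 \<cdot>\<^bsub>E\<^esub> pb1 E (d1 S) (d0 S)) (F1 \<cdot>\<^bsub>E\<^esub> pb2 E (d1 S) (d0 S))"

text \<open>The internal poset \<open>PC\<close> as an internal category: its object of arrows is \<open>(\<le>)\<close>;
  identities and composition are the factorizations through \<open>(\<le>)\<close> given by reflexivity and
  transitivity, unique since \<open>(\<le>) \<rightarrow> PC \<times> PC\<close> is monic.\<close>

definition Pow_icat :: "('o, 'a, 'm) topos_data_scheme \<Rightarrow> 'o \<Rightarrow> ('o, 'a) icat"
  where "Pow_icat E C =
    (let PC = Pow_obj E C; le = le_Pow E C;
         s = Fst E PC PC \<cdot>\<^bsub>E\<^esub> le; t = Snd E PC PC \<cdot>\<^bsub>E\<^esub> le in
      \<lparr> obs = PC,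
        arrs = Dom E le,
        d0 = s,
        d1 = t,
        idt = (THE u. u \<in> hom E PC (Dom E le) \<and>
          le \<cdot>\<^bsub>E\<^esub> u = pair E (Ident E PC) (Ident E PC)),
        cmp = (THE u. u \<in> hom E (pb_obj E t s) (Dom E le) \<and>
          le \<cdot>\<^bsub>E\<^esub> u = pair E (s \<cdot>\<^bsub>E\<^esub> pb1 E t s) (t \<cdot>\<^bsub>E\<^esub> pb2 E t s)) \<rparr>)"


section \<open>Estimate consensus protocols\<close>

locale estimate_consensus_protocol = internal_category E \<Sigma>
  for E :: "('o, 'a, 'm) topos_data_scheme" (structure)
    and C :: 'o and \<Sigma> :: "('o, 'a) icat" and e0 e1 :: 'a +
  assumes consensus_obj: "C \<in> Obj E"
    and estimate_functor: "internal_functor E \<Sigma> (Pow_icat E C) e0 e1"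
    and estimate_consistent:
      "\<lbrakk>w \<in> hom E X (obs \<Sigma>); p \<in> propositions E C;
        imp E C (e0 \<cdot> w) (prop_on E p X) = truth_on E X\<rbrakk>
      \<Longrightarrow> not_Omega E \<cdot> imp E C (e0 \<cdot> w) (prop_on E (neg_Pow E C p) X) = truth_on E X"

text \<open>\<open>(f, r)\<close> is an execution \<open>w \<rightarrow> v\<close>.\<close>

definition execution ::
    "('o, 'a, 'm) topos_data_scheme \<Rightarrow> ('o, 'a) icat \<Rightarrow> 'a \<Rightarrow> 'a \<Rightarrow> 'a \<Rightarrow> 'a \<Rightarrow> bool"
  where "execution E S f r w v \<longleftrightarrow>
    f \<in> hom E (Dom E f) (arrs S) \<and> r \<in> hom E (Dom E f) (Dom E w) \<and> epic E r \<and>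
    d0 S \<cdot>\<^bsub>E\<^esub> f = w \<cdot>\<^bsub>E\<^esub> r \<and> v = d1 S \<cdot>\<^bsub>E\<^esub> f"

definition compatible ::
    "('o, 'a, 'm) topos_data_scheme \<Rightarrow> ('o, 'a) icat \<Rightarrow> 'a \<Rightarrow> 'a \<Rightarrow> bool"
  where "compatible E S w1 w2 \<longleftrightarrow>
    (\<exists>X w3 f1 r1 f2 r2. w3 \<in> hom E X (obs S) \<and>
      execution E S f1 r1 w1 w3 \<and> execution E S f2 r2 w2 w3)"

text \<open>\<open>safe E C S e0 w p\<close> is \<open>w \<tturnstile> (x \<Rightarrow> p)\<close>; the vertex of the pullback of \<open>w\<close> and \<open>d0\<close>
  is \<open>\<Sigma>(w, -)\<close>.\<close>

definition safe ::
    "('o, 'a, 'm) topos_data_scheme \<Rightarrow> 'o \<Rightarrow> ('o, 'a) icat \<Rightarrow> 'a \<Rightarrow> 'a \<Rightarrow> 'a \<Rightarrow> bool"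
  where "safe E C S e0 w p \<longleftrightarrow>
    imp E C (e0 \<cdot>\<^bsub>E\<^esub> d1 S \<cdot>\<^bsub>E\<^esub> pb2 E w (d0 S)) (prop_on E p (pb_obj E w (d0 S)))
      = truth_on E (pb_obj E w (d0 S))"

end

theory Submission
  imports Defs
begin

text \<open>Let \<open>w\<^sub>3 : X \<rightarrow> \<Sigma>\<^sub>0\<close> be the common target of executions on \<open>w\<^sub>1\<close> and \<open>w\<^sub>2\<close>, and suppose that both
  safety claims hold. Safety means that the estimate of every reachable state implies the
  proposition, so \<open>e\<^sub>0 w\<^sub>3\<close> lies below both \<open>p\<close> and \<open>q\<close> (\<open>safe_execution\<close>). As \<open>p \<and> q = \<bottom>\<close>,
  \<open>q \<le> \<not> p\<close>, so \<open>e\<^sub>0 w\<^sub>3\<close> lies below \<open>\<not> p\<close> (\<open>disjoint_imp_neg\<close>). Since it also lies below \<open>p\<close>,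
  consistency of estimates says that \<open>\<not> (e\<^sub>0 w\<^sub>3 \<Rightarrow> \<not> p)\<close> is true on \<open>X\<close>. Hence \<open>\<not> \<top> = \<top>\<close> on
  \<open>X\<close>, which makes \<open>X\<close> initial (\<open>not_truth_on_imp_initial\<close>). An execution comes with an
  epimorphism \<open>X \<rightarrow> W\<^sub>1\<close>, and epimorphisms out of an initial object have initial codomain
  (\<open>initial_epic\<close>), contrary to the assumption on \<open>W\<^sub>1\<close>. That assumption excludes the states at
  the initial stage, where all parallel arrows agree and every proposition is safe.

  This argument needs false, negation, the bottom of \<open>PC\<close> and pseudocomplements to behave as
  their definitions by unique description suggest, which amounts to showing that they exist. The
  method throughout is Kripke--Joyal forcing: an arrow into \<open>\<Omega>\<close> is determined by the generalized
  elements at which it becomes true (\<open>omega_eqI\<close>), an arrow into \<open>PC\<close> by the generalized elements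
  of \<open>C\<close> that belong to it (\<open>pow_eqI\<close>), and each operation has a clause: false is forced exactly
  at initial stages, and negation is forced at \<open>X\<close> if every stage over \<open>X\<close> that forces the
  argument is initial.

  The existence of an initial object has to be derived, since a topos is given by finite
  limits, exponentials and \<open>\<Omega>\<close>. Call \<open>X\<close> degenerate if over \<open>X\<close> every truth value is true. Every
  monomorphism into such an object is split, which forces exactly one arrow from \<open>X\<close> to
  anything (\<open>degenerate_imp_initial\<close>); and the largest degenerate subobject of \<open>1\<close>, the truth
  value of \<open>\<forall>\<omega>. \<omega>\<close>, is an equalizer of two global elements of \<open>\<Omega>\<^sup>\<Omega>\<close> (\<open>degenerate_exists\<close>).\<close>


section \<open>Calculating with finite limits\<close>

context category
begin

lemma homD:
  assumes "f \<in> hom E A B"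
  shows "f \<in> Arr E" "Dom E f = A" "Cod E f = B" "A \<in> Obj E" "B \<in> Obj E"
  using assms dom_obj cod_obj by (auto simp: hom_def)

lemma monic_equalizer:
  assumes "is_equalizer E f g m" and "f \<in> hom E A B" and "g \<in> hom E A B"
  shows "monic E m"
proof -
  have m: "m \<in> hom E (Dom E m) A" and eq: "f \<cdot> m = g \<cdot> m"
    and uni: "\<And>X h. h \<in> hom E X A \<Longrightarrow> f \<cdot> h = g \<cdot> h \<Longrightarrow>
      \<exists>!u. u \<in> hom E X (Dom E m) \<and> m \<cdot> u = h"
    using assms(1) homD(2)[OF assms(2)] by (auto simp: is_equalizer_def)
  show ?thesis
    unfolding monic_def
  proof (intro conjI allI ballI impI)
    show "m \<in> Arr E" using homD(1)[OF m] .
  next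
    fix X a b assume a: "a \<in> hom E X (Dom E m)" and b: "b \<in> hom E X (Dom E m)"
      and ab: "m \<cdot> a = m \<cdot> b"
    have "f \<cdot> (m \<cdot> a) = g \<cdot> (m \<cdot> a)"
      using compose_assoc[OF a m assms(2)] compose_assoc[OF a m assms(3)] eq by simp
    with uni[OF compose_hom[OF a m]] a b ab show "a = b" by metis
  qed
qed

lemma initial_arrow_eq:
  assumes "initial E X" and "f \<in> hom E X A" and "g \<in> hom E X A"
  shows "f = g"
  using assms homD(5)[OF assms(2)] by (auto simp: initial_def)

end

context elementary_topos
begin

lemma one_obj: "One E \<in> Obj E"
  using one_terminal by (simp add: terminal_def)

lemma omega_obj: "Omega E \<in> Obj E"
  using homD(5)[OF truth_hom] .

lemma one_arrow_eq:
  assumes "f \<in> hom E X (One E)" and "g \<in> hom E X (One E)"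
  shows "f = g"
  using assms homD(4)[OF assms(1)] one_terminal by (auto simp: terminal_def)

lemma bang_hom: "X \<in> Obj E \<Longrightarrow> bang E X \<in> hom E X (One E)"
  using one_terminal unfolding terminal_def bang_def by (metis theI')

lemma bang_compose: "h \<in> hom E Y X \<Longrightarrow> bang E X \<cdot> h = bang E Y"
  by (meson one_arrow_eq bang_hom compose_hom homD(4,5))

lemma bang_one: "bang E (One E) = Ident E (One E)"
  by (meson one_arrow_eq bang_hom ident_hom one_obj)

lemma truth_on_hom: "X \<in> Obj E \<Longrightarrow> truth_on E X \<in> hom E X (Omega E)"
  unfolding truth_on_def by (rule compose_hom[OF bang_hom truth_hom])

lemma truth_on_compose:
  assumes "h \<in> hom E Y X"
  shows "truth_on E X \<cdot> h = truth_on E Y"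
  unfolding truth_on_def
  using compose_assoc[OF assms bang_hom[OF homD(5)[OF assms]] truth_hom]
  by (simp add: bang_compose[OF assms])

lemma pair_hom_proj:
  assumes f: "f \<in> hom E X A" and g: "g \<in> hom E X B"
  shows "pair E f g \<in> hom E X (Prod E A B) \<and>
    Fst E A B \<cdot> pair E f g = f \<and> Snd E A B \<cdot> pair E f g = g"
proof -
  have "\<exists>!u. u \<in> hom E X (Prod E A B) \<and> Fst E A B \<cdot> u = f \<and> Snd E A B \<cdot> u = g"
    using prod_product[OF homD(5)[OF f] homD(5)[OF g]] f g by (auto simp: is_product_def)
  from theI'[OF this] show ?thesis
    unfolding pair_def homD(2)[OF f] homD(3)[OF f] homD(3)[OF g] .
qed

lemmas pair_hom = pair_hom_proj[THEN conjunct1]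
lemmas fst_pair = pair_hom_proj[THEN conjunct2, THEN conjunct1]
lemmas snd_pair = pair_hom_proj[THEN conjunct2, THEN conjunct2]

lemma fst_hom: "\<lbrakk>A \<in> Obj E; B \<in> Obj E\<rbrakk> \<Longrightarrow> Fst E A B \<in> hom E (Prod E A B) A"
  and snd_hom: "\<lbrakk>A \<in> Obj E; B \<in> Obj E\<rbrakk> \<Longrightarrow> Snd E A B \<in> hom E (Prod E A B) B"
  using prod_product by (auto simp: is_product_def)

lemma prod_obj: "\<lbrakk>A \<in> Obj E; B \<in> Obj E\<rbrakk> \<Longrightarrow> Prod E A B \<in> Obj E"
  using homD(4)[OF fst_hom] .

lemma pair_eqI:
  assumes A: "A \<in> Obj E" and B: "B \<in> Obj E"
    and u: "u \<in> hom E X (Prod E A B)" and v: "v \<in> hom E X (Prod E A B)"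
    and eq: "Fst E A B \<cdot> u = Fst E A B \<cdot> v" "Snd E A B \<cdot> u = Snd E A B \<cdot> v"
  shows "u = v"
proof -
  have "\<exists>!k. k \<in> hom E X (Prod E A B) \<and> Fst E A B \<cdot> k = Fst E A B \<cdot> u
      \<and> Snd E A B \<cdot> k = Snd E A B \<cdot> u"
    using prod_product[OF A B] compose_hom[OF u fst_hom[OF A B]]
      compose_hom[OF u snd_hom[OF A B]]
    unfolding is_product_def by blast
  with u v eq show ?thesis by metis
qed

lemma pair_surj:
  assumes A: "A \<in> Obj E" and B: "B \<in> Obj E" and u: "u \<in> hom E X (Prod E A B)"
  shows "pair E (Fst E A B \<cdot> u) (Snd E A B \<cdot> u) = u"
proof -
  note f = compose_hom[OF u fst_hom[OF A B]] and g = compose_hom[OF u snd_hom[OF A B]]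
  show ?thesis
    using pair_eqI[OF A B pair_hom[OF f g] u] fst_pair[OF f g] snd_pair[OF f g] by simp
qed

lemma pair_compose:
  assumes f: "f \<in> hom E X A" and g: "g \<in> hom E X B" and h: "h \<in> hom E Y X"
  shows "pair E f g \<cdot> h = pair E (f \<cdot> h) (g \<cdot> h)"
proof -
  note A = homD(5)[OF f] and B = homD(5)[OF g] and fg = pair_hom[OF f g]
  note fh = compose_hom[OF h f] and gh = compose_hom[OF h g]
  show ?thesis
    by (intro pair_eqI[OF A B compose_hom[OF h fg] pair_hom[OF fh gh]])
      (simp_all add: compose_assoc[OF h fg fst_hom[OF A B], symmetric]
        compose_assoc[OF h fg snd_hom[OF A B], symmetric]
        fst_pair[OF f g] snd_pair[OF f g] fst_pair[OF fh gh] snd_pair[OF fh gh])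
qed

lemma cross_hom:
  assumes "f \<in> hom E A A'" and "g \<in> hom E B B'"
  shows "cross E f g \<in> hom E (Prod E A B) (Prod E A' B')"
  unfolding cross_def homD(2)[OF assms(1)] homD(2)[OF assms(2)]
  using assms by (intro pair_hom compose_hom[OF fst_hom] compose_hom[OF snd_hom] homD(4))

lemma cross_pair:
  assumes f: "f \<in> hom E A A'" and g: "g \<in> hom E B B'"
    and h: "h \<in> hom E X A" and k: "k \<in> hom E X B"
  shows "cross E f g \<cdot> pair E h k = pair E (f \<cdot> h) (g \<cdot> k)"
proof -
  note A = homD(4)[OF f] and B = homD(4)[OF g]
  note p1 = fst_hom[OF A B] and p2 = snd_hom[OF A B] and hk = pair_hom[OF h k]
  show ?thesis
    unfolding cross_def homD(2)[OF f] homD(2)[OF g]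
      pair_compose[OF compose_hom[OF p1 f] compose_hom[OF p2 g] hk]
      compose_assoc[OF hk p1 f] compose_assoc[OF hk p2 g] fst_pair[OF h k] snd_pair[OF h k] ..
qed

lemma curry_hom_ev:
  assumes C: "C \<in> Obj E" and X: "X \<in> Obj E" and a: "a \<in> hom E (Prod E C X) B"
  shows "curry_arr E C X a \<in> hom E X (Exp E C B) \<and>
    Ev E C B \<cdot> cross E (Ident E C) (curry_arr E C X a) = a"
  using theI'[OF ev_universal[OF C homD(5)[OF a] X a]]
  unfolding curry_arr_def homD(3)[OF a] .

lemma ev_cross_pair:
  assumes s: "s \<in> hom E X (Exp E C B)" and C: "C \<in> Obj E" and B: "B \<in> Obj E"
    and c: "c \<in> hom E Y C" and h: "h \<in> hom E Y X"
  shows "(Ev E C B \<cdot> cross E (Ident E C) s) \<cdot> pair E c h = Ev E C B \<cdot> pair E c (s \<cdot> h)"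
  using compose_assoc[OF pair_hom[OF c h] cross_hom[OF ident_hom[OF C] s] ev_hom[OF C B]]
    cross_pair[OF ident_hom[OF C] s c h] ident_compose[OF c] by simp

lemma ev_curry:
  assumes C: "C \<in> Obj E" and X: "X \<in> Obj E" and a: "a \<in> hom E (Prod E C X) B"
    and c: "c \<in> hom E Y C" and h: "h \<in> hom E Y X"
  shows "Ev E C B \<cdot> pair E c (curry_arr E C X a \<cdot> h) = a \<cdot> pair E c h"
  using ev_cross_pair[OF conjunct1[OF curry_hom_ev[OF C X a]] C homD(5)[OF a] c h]
    curry_hom_ev[OF C X a] by simp

lemma pullback_universal:
  assumes f: "f \<in> hom E A D" and g: "g \<in> hom E B D"
  shows "pb2 E f g \<in> hom E (pb_obj E f g) B"
    and "\<lbrakk>h \<in> hom E X A; k \<in> hom E X B; f \<cdot> h = g \<cdot> k\<rbrakk>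
      \<Longrightarrow> \<exists>u\<in>hom E X (pb_obj E f g). pb2 E f g \<cdot> u = k"
proof -
  note A = homD(4)[OF f] and B = homD(4)[OF g]
  note p = fst_hom[OF A B] and q = snd_hom[OF A B]
  note fp = compose_hom[OF p f] and gq = compose_hom[OF q g]
  let ?m = "pb_arr E f g"
  have m_def: "?m = Eq E (f \<cdot> Fst E A B) (g \<cdot> Snd E A B)"
    unfolding pb_arr_def homD(2)[OF f] homD(2)[OF g] ..
  have eq: "is_equalizer E (f \<cdot> Fst E A B) (g \<cdot> Snd E A B) ?m"
    unfolding m_def by (rule eq_equalizer[OF fp gq])
  have m: "?m \<in> hom E (pb_obj E f g) (Prod E A B)"
    using eq unfolding is_equalizer_def pb_obj_def homD(2)[OF fp] by blast
  have pb2: "pb2 E f g = Snd E A B \<cdot> ?m"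
    unfolding pb2_def homD(2)[OF f] homD(2)[OF g] ..
  show "pb2 E f g \<in> hom E (pb_obj E f g) B"
    unfolding pb2 by (rule compose_hom[OF m q])
  assume h: "h \<in> hom E X A" and k: "k \<in> hom E X B" and hk: "f \<cdot> h = g \<cdot> k"
  note u = pair_hom[OF h k]
  have "(f \<cdot> Fst E A B) \<cdot> pair E h k = (g \<cdot> Snd E A B) \<cdot> pair E h k"
    using compose_assoc[OF u p f] compose_assoc[OF u q g] fst_pair[OF h k] snd_pair[OF h k] hk
    by simp
  then obtain v where v: "v \<in> hom E X (pb_obj E f g)" "?m \<cdot> v = pair E h k"
    using eq u unfolding is_equalizer_def pb_obj_def homD(2)[OF fp] by blast
  then have "pb2 E f g \<cdot> v = k"
    unfolding pb2 using compose_assoc[OF v(1) m q] snd_pair[OF h k] by simp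
  with v(1) show "\<exists>u\<in>hom E X (pb_obj E f g). pb2 E f g \<cdot> u = k" by blast
qed

section \<open>Truth values at generalized elements\<close>

text \<open>The second component of a cone over \<open>c\<close> and \<open>\<top>\<close> is an arrow to \<open>1\<close>, so the pullback property
  only speaks about which arrows factor through \<open>m\<close>.\<close>

lemma pullback_truth_iff:
  assumes m: "m \<in> hom E K X" and mon: "monic E m" and c: "c \<in> hom E X (Omega E)"
  shows "is_pullback E c (Truth E) m (bang E K) \<longleftrightarrow>
    (\<forall>Y. \<forall>h\<in>hom E Y X. c \<cdot> h = truth_on E Y \<longleftrightarrow> (\<exists>u\<in>hom E Y K. m \<cdot> u = h))"
    (is "?L \<longleftrightarrow> ?R")
proof
  assume L: ?L
  show ?R
  proof (intro allI ballI iffI)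
    fix Y h assume h: "h \<in> hom E Y X" and "c \<cdot> h = truth_on E Y"
    with L bang_hom[OF homD(4)[OF h]] show "\<exists>u\<in>hom E Y K. m \<cdot> u = h"
      unfolding is_pullback_def truth_on_def homD(2)[OF c] homD(2)[OF truth_hom]
        homD(2)[OF m] by blast
  next
    fix Y h assume h: "h \<in> hom E Y X" and "\<exists>u\<in>hom E Y K. m \<cdot> u = h"
    then obtain u where u: "u \<in> hom E Y K" "m \<cdot> u = h" by blast
    have "c \<cdot> m = truth_on E K"
      using L unfolding is_pullback_def truth_on_def by blast
    then show "c \<cdot> h = truth_on E Y"
      using compose_assoc[OF u(1) m c] u(2) truth_on_compose[OF u(1)] by simp
  qed
next
  assume R: ?R
  have cm: "c \<cdot> m = truth_on E K"
    using R m ident_hom[OF homD(4)[OF m]] compose_ident[OF m] by blast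
  show ?L
    unfolding is_pullback_def homD(2)[OF c] homD(2)[OF truth_hom] homD(2)[OF m]
  proof (intro conjI allI ballI impI)
    show "m \<in> hom E K X" by (rule m)
    show "bang E K \<in> hom E K (One E)" by (rule bang_hom[OF homD(4)[OF m]])
    show "c \<cdot> m = Truth E \<cdot> bang E K" using cm by (simp add: truth_on_def)
  next
    fix Y h k assume h: "h \<in> hom E Y X" and k: "k \<in> hom E Y (One E)"
      and "c \<cdot> h = Truth E \<cdot> k"
    then have "c \<cdot> h = truth_on E Y"
      using one_arrow_eq[OF k bang_hom[OF homD(4)[OF h]]] by (simp add: truth_on_def)
    with R h obtain u where u: "u \<in> hom E Y K" "m \<cdot> u = h" by blast
    moreover have "bang E K \<cdot> u = k"
      using one_arrow_eq[OF compose_hom[OF u(1) bang_hom[OF homD(4)[OF m]]] k] .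
    moreover have "u' = u" if "u' \<in> hom E Y K" "m \<cdot> u' = h" for u'
      using mon that u unfolding monic_def homD(2)[OF m] by blast
    ultimately show "\<exists>!u. u \<in> hom E Y K \<and> m \<cdot> u = h \<and> bang E K \<cdot> u = k" by blast
  qed
qed

lemma char_arr_hom:
  assumes m: "m \<in> hom E K X" and "monic E m"
  shows "char_arr E m \<in> hom E X (Omega E)"
  using theI'[OF truth_classifies[OF assms(2)]] homD(3)[OF m] by (simp add: char_arr_def)

lemma char_arr_true_iff:
  assumes m: "m \<in> hom E K X" and mon: "monic E m" and h: "h \<in> hom E Y X"
  shows "char_arr E m \<cdot> h = truth_on E Y \<longleftrightarrow> (\<exists>u\<in>hom E Y K. m \<cdot> u = h)"
proof -
  have "is_pullback E (char_arr E m) (Truth E) m (bang E K)"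
    using theI'[OF truth_classifies[OF mon]] homD(2)[OF m] by (simp add: char_arr_def)
  then show ?thesis
    using pullback_truth_iff[OF m mon char_arr_hom[OF m mon]] h by blast
qed

text \<open>Two arrows to \<open>\<Omega>\<close> that are true at the same generalized elements classify the same subobject,
  the equalizer of either of them with \<open>\<top>\<close>, and the classifying arrow is unique.\<close>

lemma omega_eqI:
  assumes a: "a \<in> hom E X (Omega E)" and b: "b \<in> hom E X (Omega E)"
    and ext: "\<And>Y h. h \<in> hom E Y X \<Longrightarrow> a \<cdot> h = truth_on E Y \<longleftrightarrow> b \<cdot> h = truth_on E Y"
  shows "a = b"
proof -
  define m where "m = Eq E a (truth_on E X)"
  define K where "K = Dom E m"
  note t = truth_on_hom[OF homD(4)[OF a]]
  have eq: "is_equalizer E a (truth_on E X) m"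
    unfolding m_def by (rule eq_equalizer[OF a t])
  note mon = monic_equalizer[OF eq a t]
  have m: "m \<in> hom E K X"
    using eq homD(2)[OF a] by (simp add: is_equalizer_def K_def)
  have am: "a \<cdot> m = truth_on E K"
    using eq truth_on_compose[OF m] by (simp add: is_equalizer_def)
  have true_iff: "a \<cdot> h = truth_on E Y \<longleftrightarrow> (\<exists>u\<in>hom E Y K. m \<cdot> u = h)"
    if h: "h \<in> hom E Y X" for Y h
  proof
    assume "a \<cdot> h = truth_on E Y"
    then have "a \<cdot> h = truth_on E X \<cdot> h" using truth_on_compose[OF h] by simp
    then show "\<exists>u\<in>hom E Y K. m \<cdot> u = h"
      using eq h unfolding is_equalizer_def K_def homD(2)[OF a] by blast
  next
    assume "\<exists>u\<in>hom E Y K. m \<cdot> u = h"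
    then obtain u where u: "u \<in> hom E Y K" "m \<cdot> u = h" by blast
    then show "a \<cdot> h = truth_on E Y"
      using compose_assoc[OF u(1) m a] am truth_on_compose[OF u(1)] by simp
  qed
  have "is_pullback E a (Truth E) m (bang E K)" "is_pullback E b (Truth E) m (bang E K)"
    unfolding pullback_truth_iff[OF m mon a] pullback_truth_iff[OF m mon b]
    using true_iff ext by auto
  with truth_classifies[OF mon] a b show "a = b"
    unfolding homD(2)[OF m] homD(3)[OF m] by blast
qed

section \<open>The initial object\<close>

text \<open>Quantifying over all stages \<open>h : Y \<rightarrow> X\<close> says that the internal statement \<open>\<forall>\<omega>. \<omega>\<close> holds at \<open>X\<close>.
  It is shown below that this is another description of the initial objects; the advantage is
  its evident stability under arrows into \<open>X\<close>.\<close>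

definition degenerate :: "'o \<Rightarrow> bool"
  where "degenerate X \<longleftrightarrow> X \<in> Obj E \<and>
    (\<forall>Y. \<forall>h\<in>hom E Y X. \<forall>a\<in>hom E Y (Omega E). a = truth_on E Y)"

lemma degenerate_compose:
  assumes "degenerate X" and h: "h \<in> hom E Y X"
  shows "degenerate Y"
  using assms(1) homD(4)[OF h] compose_hom[OF _ h] unfolding degenerate_def by blast

text \<open>The classifying arrow of a subobject of \<open>X\<close> is true by degeneracy, so the subobject is all of
  \<open>X\<close>.\<close>

lemma degenerate_monic_section:
  assumes X: "degenerate X" and m: "m \<in> hom E K X" and mon: "monic E m"
  shows "\<exists>u\<in>hom E X K. m \<cdot> u = Ident E X"
proof -
  note c = char_arr_hom[OF m mon] and i = ident_hom[OF homD(5)[OF m]]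
  have "char_arr E m = truth_on E X"
    using X c i unfolding degenerate_def by blast
  then show ?thesis
    using char_arr_true_iff[OF m mon i] compose_ident[OF c] by simp
qed

text \<open>The equalizer of \<open>f\<close> and \<open>g\<close> is monic and hence has a section.\<close>

lemma degenerate_arrow_eq:
  assumes X: "degenerate X" and f: "f \<in> hom E X B" and g: "g \<in> hom E X B"
  shows "f = g"
proof -
  define m where "m = Eq E f g"
  have eq: "is_equalizer E f g m" unfolding m_def by (rule eq_equalizer[OF f g])
  then have m: "m \<in> hom E (Dom E m) X" and fg: "f \<cdot> m = g \<cdot> m"
    unfolding is_equalizer_def homD(2)[OF f] by auto
  obtain u where u: "u \<in> hom E X (Dom E m)" "m \<cdot> u = Ident E X"
    using degenerate_monic_section[OF X m monic_equalizer[OF eq f g]] by blast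
  show ?thesis
    using compose_assoc[OF u(1) m f] compose_assoc[OF u(1) m g] fg u(2)
      compose_ident[OF f] compose_ident[OF g] by metis
qed

text \<open>The projection \<open>X \<times> A \<rightarrow> X\<close> is monic, as any two arrows into \<open>X \<times> A\<close> start at a degenerate
  object and so agree. A section of it, followed by the other projection, is an arrow \<open>X \<rightarrow> A\<close>.\<close>

lemma degenerate_arrow_exists:
  assumes X: "degenerate X" and A: "A \<in> Obj E"
  shows "\<exists>f. f \<in> hom E X A"
proof -
  have XO: "X \<in> Obj E" using X by (simp add: degenerate_def)
  note p = fst_hom[OF XO A]
  have "g = h" if "g \<in> hom E Y (Prod E X A)" "h \<in> hom E Y (Prod E X A)" for Y g h
    using degenerate_arrow_eq[OF degenerate_compose[OF X compose_hom[OF that(1) p]] that] .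
  then have "monic E (Fst E X A)"
    unfolding monic_def homD(2)[OF p] using homD(1)[OF p] by blast
  from degenerate_monic_section[OF X p this] obtain u where "u \<in> hom E X (Prod E X A)" by blast
  from compose_hom[OF this snd_hom[OF XO A]] show ?thesis ..
qed

lemma degenerate_imp_initial:
  assumes X: "degenerate X"
  shows "initial E X"
  unfolding initial_def
proof (intro conjI ballI)
  show "X \<in> Obj E" using X by (simp add: degenerate_def)
  fix A assume "A \<in> Obj E"
  from degenerate_arrow_exists[OF X this] show "\<exists>!f. f \<in> hom E X A"
    using degenerate_arrow_eq[OF X] by blast
qed

text \<open>In the proof, \<open>s\<close> and \<open>i\<close> are the names \<open>1 \<rightarrow> \<Omega>\<^sup>\<Omega>\<close> of the constant map \<open>\<top>\<close> and of the identity. At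
  a stage over their equalizer they coincide, and applying them to a truth value \<open>a\<close> gives
  \<open>\<top> = a\<close>.\<close>

lemma degenerate_exists: "\<exists>Z. degenerate Z"
proof -
  note O1 = prod_obj[OF omega_obj one_obj]
  note t = truth_on_hom[OF O1] and p = fst_hom[OF omega_obj one_obj]
  define s where "s = curry_arr E (Omega E) (One E) (truth_on E (Prod E (Omega E) (One E)))"
  define i where "i = curry_arr E (Omega E) (One E) (Fst E (Omega E) (One E))"
  have s: "s \<in> hom E (One E) (Exp E (Omega E) (Omega E))"
    and i: "i \<in> hom E (One E) (Exp E (Omega E) (Omega E))"
    unfolding s_def i_def
    using curry_hom_ev[OF omega_obj one_obj t] curry_hom_ev[OF omega_obj one_obj p] by auto
  define m where "m = Eq E s i"
  have "is_equalizer E s i m" unfolding m_def by (rule eq_equalizer[OF s i])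
  then have m: "m \<in> hom E (Dom E m) (One E)" and eq: "s \<cdot> m = i \<cdot> m"
    unfolding is_equalizer_def homD(2)[OF s] by auto
  have "a = truth_on E Y" if h: "h \<in> hom E Y (Dom E m)" and a: "a \<in> hom E Y (Omega E)" for Y h a
  proof -
    note k = compose_hom[OF h m]
    have "a = Fst E (Omega E) (One E) \<cdot> pair E a (m \<cdot> h)"
      by (simp add: fst_pair[OF a k])
    also have "\<dots> = Ev E (Omega E) (Omega E) \<cdot> pair E a (i \<cdot> (m \<cdot> h))"
      unfolding i_def by (rule ev_curry[OF omega_obj one_obj p a k, symmetric])
    also have "i \<cdot> (m \<cdot> h) = s \<cdot> (m \<cdot> h)"
      using compose_assoc[OF h m i] compose_assoc[OF h m s] eq by simp
    also have "Ev E (Omega E) (Omega E) \<cdot> pair E a (s \<cdot> (m \<cdot> h))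
        = truth_on E (Prod E (Omega E) (One E)) \<cdot> pair E a (m \<cdot> h)"
      unfolding s_def by (rule ev_curry[OF omega_obj one_obj t a k])
    also have "\<dots> = truth_on E Y" by (rule truth_on_compose[OF pair_hom[OF a k]])
    finally show ?thesis .
  qed
  then show ?thesis
    using homD(4)[OF m] by (auto simp: degenerate_def)
qed

text \<open>An initial object has an arrow to the degenerate object constructed above, and degeneracy is
  inherited along arrows.\<close>

lemma initial_iff_degenerate: "initial E X \<longleftrightarrow> degenerate X"
proof
  assume "initial E X"
  moreover obtain Z where Z: "degenerate Z" using degenerate_exists ..
  ultimately obtain h where "h \<in> hom E X Z"
    by (auto simp: initial_def degenerate_def)
  then show "degenerate X" by (rule degenerate_compose[OF Z])
qed (rule degenerate_imp_initial)

lemma initial_strict: "\<lbrakk>initial E Z; h \<in> hom E X Z\<rbrakk> \<Longrightarrow> initial E X"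
  unfolding initial_iff_degenerate by (rule degenerate_compose)

lemma initial_exists: "\<exists>Z. initial E Z"
  unfolding initial_iff_degenerate by (rule degenerate_exists)

section \<open>False, negation and conjunction\<close>

text \<open>By strictness of \<open>Z\<close>, any two arrows into \<open>Z\<close> agree and so \<open>Z \<rightarrow> 1\<close> is monic; and an object has an
  arrow to \<open>Z\<close> precisely if it is initial.\<close>

lemma initial_bang_classifier:
  assumes Z: "initial E Z"
  shows "char_arr E (bang E Z) \<in> hom E (One E) (Omega E)"
    and "X \<in> Obj E \<Longrightarrow> char_arr E (bang E Z) \<cdot> bang E X = truth_on E X \<longleftrightarrow> initial E X"
proof -
  have ZO: "Z \<in> Obj E" using Z by (simp add: initial_def)
  note b = bang_hom[OF ZO]
  have "g = h" if "g \<in> hom E Y Z" "h \<in> hom E Y Z" for Y g h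
    using initial_arrow_eq[OF initial_strict[OF Z that(1)] that] .
  then have mon: "monic E (bang E Z)"
    unfolding monic_def homD(2)[OF b] using homD(1)[OF b] by blast
  show "char_arr E (bang E Z) \<in> hom E (One E) (Omega E)" by (rule char_arr_hom[OF b mon])
  assume X: "X \<in> Obj E"
  show "char_arr E (bang E Z) \<cdot> bang E X = truth_on E X \<longleftrightarrow> initial E X"
    unfolding char_arr_true_iff[OF b mon bang_hom[OF X]]
    using initial_strict[OF Z] bang_compose Z X unfolding initial_def by metis
qed

text \<open>The forcing clause of \<open>initial_bang_classifier\<close> does not mention \<open>Z\<close>, so all initial objects give
  the same truth value.\<close>

lemma false_Omega_eq:
  assumes Z: "initial E Z"
  shows "false_Omega E = char_arr E (bang E Z)"
  unfolding false_Omega_def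
proof (rule the_equality)
  show "\<exists>Z'. initial E Z' \<and> char_arr E (bang E Z) = char_arr E (bang E Z')"
    using Z by blast
next
  fix b assume "\<exists>Z'. initial E Z' \<and> b = char_arr E (bang E Z')"
  then obtain Z' where Z': "initial E Z'" and b: "b = char_arr E (bang E Z')" by blast
  show "b = char_arr E (bang E Z)"
    unfolding b
  proof (rule omega_eqI[OF initial_bang_classifier(1)[OF Z'] initial_bang_classifier(1)[OF Z]])
    fix Y h assume h: "h \<in> hom E Y (One E)"
    note Y = homD(4)[OF h]
    have "h = bang E Y" by (rule one_arrow_eq[OF h bang_hom[OF Y]])
    then show "char_arr E (bang E Z') \<cdot> h = truth_on E Y
        \<longleftrightarrow> char_arr E (bang E Z) \<cdot> h = truth_on E Y"
      using initial_bang_classifier(2)[OF Z Y] initial_bang_classifier(2)[OF Z' Y] by simp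
  qed
qed

lemma false_Omega_hom: "false_Omega E \<in> hom E (One E) (Omega E)"
  using initial_exists initial_bang_classifier(1) false_Omega_eq by metis

lemma false_true_iff:
  "X \<in> Obj E \<Longrightarrow> false_Omega E \<cdot> bang E X = truth_on E X \<longleftrightarrow> initial E X"
  using initial_exists initial_bang_classifier(2) false_Omega_eq by metis

lemma false_on_compose:
  assumes h: "h \<in> hom E Y X"
  shows "(false_Omega E \<cdot> bang E X) \<cdot> h = false_Omega E \<cdot> bang E Y"
  using compose_assoc[OF h bang_hom[OF homD(5)[OF h]] false_Omega_hom] bang_compose[OF h] by simp

text \<open>The condition on the right is the forcing clause for \<open>a \<le> \<bottom>\<close>; the converse inequality holds since
  at an initial stage any two truth values agree.\<close>

lemma false_on_iff:
  assumes a: "a \<in> hom E X (Omega E)"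
  shows "a = false_Omega E \<cdot> bang E X \<longleftrightarrow>
    (\<forall>Y. \<forall>h\<in>hom E Y X. a \<cdot> h = truth_on E Y \<longrightarrow> initial E Y)"
proof
  assume "a = false_Omega E \<cdot> bang E X"
  then show "\<forall>Y. \<forall>h\<in>hom E Y X. a \<cdot> h = truth_on E Y \<longrightarrow> initial E Y"
    using false_on_compose false_true_iff homD(4) by metis
next
  assume *: "\<forall>Y. \<forall>h\<in>hom E Y X. a \<cdot> h = truth_on E Y \<longrightarrow> initial E Y"
  show "a = false_Omega E \<cdot> bang E X"
  proof (rule omega_eqI[OF a compose_hom[OF bang_hom[OF homD(4)[OF a]] false_Omega_hom]])
    fix Y h assume h: "h \<in> hom E Y X"
    have "initial E Y \<Longrightarrow> a \<cdot> h = truth_on E Y"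
      using initial_arrow_eq[OF _ compose_hom[OF h a] truth_on_hom[OF homD(4)[OF h]]] .
    then show "a \<cdot> h = truth_on E Y \<longleftrightarrow> (false_Omega E \<cdot> bang E X) \<cdot> h = truth_on E Y"
      using * h false_on_compose[OF h] false_true_iff[OF homD(4)[OF h]] by auto
  qed
qed

lemma monic_from_one:
  assumes "m \<in> hom E (One E) A"
  shows "monic E m"
  unfolding monic_def homD(2)[OF assms] using homD(1)[OF assms] one_arrow_eq by blast

text \<open>Factoring through a global element means being constant with that value. Applied to false and to
  \<open>\<langle>\<top>, \<top>\<rangle>\<close>, this yields the clauses for negation and conjunction.\<close>

lemma char_global_true_iff:
  assumes m: "m \<in> hom E (One E) A" and h: "h \<in> hom E X A"
  shows "char_arr E m \<cdot> h = truth_on E X \<longleftrightarrow> h = m \<cdot> bang E X"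
  unfolding char_arr_true_iff[OF m monic_from_one[OF m] h]
  using bang_hom[OF homD(4)[OF h]] one_arrow_eq by metis

lemma not_Omega_hom: "not_Omega E \<in> hom E (Omega E) (Omega E)"
  unfolding not_Omega_def
  by (rule char_arr_hom[OF false_Omega_hom monic_from_one[OF false_Omega_hom]])

lemma not_true_iff:
  assumes a: "a \<in> hom E X (Omega E)"
  shows "not_Omega E \<cdot> a = truth_on E X \<longleftrightarrow>
    (\<forall>Y. \<forall>h\<in>hom E Y X. a \<cdot> h = truth_on E Y \<longrightarrow> initial E Y)"
  unfolding not_Omega_def char_global_true_iff[OF false_Omega_hom a] by (rule false_on_iff[OF a])

lemma and_Omega_hom: "and_Omega E \<in> hom E (Prod E (Omega E) (Omega E)) (Omega E)"
  unfolding and_Omega_def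
  using pair_hom[OF truth_hom truth_hom] by (intro char_arr_hom monic_from_one)

lemma and_true_iff:
  assumes a: "a \<in> hom E X (Omega E)" and b: "b \<in> hom E X (Omega E)"
  shows "and_Omega E \<cdot> pair E a b = truth_on E X \<longleftrightarrow> a = truth_on E X \<and> b = truth_on E X"
proof -
  note X = homD(4)[OF a]
  note t = truth_on_hom[OF X]
  have "pair E (Truth E) (Truth E) \<cdot> bang E X = pair E (truth_on E X) (truth_on E X)"
    using pair_compose[OF truth_hom truth_hom bang_hom[OF X]] by (simp add: truth_on_def)
  then show ?thesis
    unfolding and_Omega_def
      char_global_true_iff[OF pair_hom[OF truth_hom truth_hom] pair_hom[OF a b]]
    using fst_pair[OF a b] snd_pair[OF a b] fst_pair[OF t t] snd_pair[OF t t] by metis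
qed

section \<open>Membership in power objects\<close>

text \<open>The generalized elements \<open>c : Y \<rightarrow> C\<close> and \<open>s : Y \<rightarrow> PC\<close> satisfy \<open>c \<in> s\<close> at stage \<open>Y\<close>; the
  stage is read off from \<open>c\<close>.\<close>

definition member :: "'o \<Rightarrow> 'a \<Rightarrow> 'a \<Rightarrow> bool"
  where "member C c s \<longleftrightarrow> Ev E C (Omega E) \<cdot> pair E c s = truth_on E (Dom E c)"

lemma pow_obj: "C \<in> Obj E \<Longrightarrow> Pow_obj E C \<in> Obj E"
  unfolding Pow_obj_def by (rule exp_obj[OF _ omega_obj])

lemma member_compose:
  assumes s: "s \<in> hom E X (Pow_obj E C)" and c: "c \<in> hom E X C" and h: "h \<in> hom E Y X"
    and mem: "member C c s"
  shows "member C (c \<cdot> h) (s \<cdot> h)"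
proof -
  note ev = ev_hom[OF homD(5)[OF c] omega_obj]
  have cs: "pair E c s \<in> hom E X (Prod E C (Exp E C (Omega E)))"
    using pair_hom[OF c s] by (simp add: Pow_obj_def)
  show ?thesis
    using mem compose_assoc[OF h cs ev] pair_compose[OF c s h] truth_on_compose[OF h]
    by (simp add: member_def homD(2)[OF c] homD(2)[OF compose_hom[OF h c]])
qed

lemma member_if_initial:
  assumes X: "initial E X" and s: "s \<in> hom E X (Pow_obj E C)" and c: "c \<in> hom E X C"
  shows "member C c s"
  unfolding member_def homD(2)[OF c]
  by (rule initial_arrow_eq[OF X compose_hom[OF pair_hom[OF c s]
      ev_hom[OF homD(5)[OF c] omega_obj, folded Pow_obj_def]] truth_on_hom[OF homD(4)[OF c]]])

text \<open>Extensionality is \<open>omega_eqI\<close> for the transposes \<open>C \<times> X \<rightarrow> \<Omega>\<close>, whose generalized elements are pairs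
  of an element of \<open>C\<close> and a stage over \<open>X\<close>.\<close>

lemma pow_eqI:
  assumes C: "C \<in> Obj E"
    and s: "s \<in> hom E X (Pow_obj E C)" and t: "t \<in> hom E X (Pow_obj E C)"
    and ext: "\<And>Y h c. \<lbrakk>h \<in> hom E Y X; c \<in> hom E Y C\<rbrakk>
      \<Longrightarrow> member C c (s \<cdot> h) \<longleftrightarrow> member C c (t \<cdot> h)"
  shows "s = t"
proof -
  note X = homD(4)[OF s] and ev = ev_hom[OF C omega_obj] and i = ident_hom[OF C]
  note s' = s[unfolded Pow_obj_def] and t' = t[unfolded Pow_obj_def]
  note f = compose_hom[OF cross_hom[OF i s'] ev] and g = compose_hom[OF cross_hom[OF i t'] ev]
  have "Ev E C (Omega E) \<cdot> cross E (Ident E C) s = Ev E C (Omega E) \<cdot> cross E (Ident E C) t"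
  proof (rule omega_eqI[OF f g])
    fix Y k assume k: "k \<in> hom E Y (Prod E C X)"
    define c where "c = Fst E C X \<cdot> k"
    define h where "h = Snd E C X \<cdot> k"
    have c: "c \<in> hom E Y C" and h: "h \<in> hom E Y X" and kch: "k = pair E c h"
      unfolding c_def h_def
      using k compose_hom fst_hom[OF C X] snd_hom[OF C X] pair_surj[OF C X k] by auto
    show "(Ev E C (Omega E) \<cdot> cross E (Ident E C) s) \<cdot> k = truth_on E Y
        \<longleftrightarrow> (Ev E C (Omega E) \<cdot> cross E (Ident E C) t) \<cdot> k = truth_on E Y"
      unfolding kch ev_cross_pair[OF s' C omega_obj c h] ev_cross_pair[OF t' C omega_obj c h]
      using ext[OF h c] by (simp add: member_def homD(2)[OF c])
  qed
  then show ?thesis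
    using ev_universal[OF C omega_obj X g] s' t' by blast
qed

lemma comprehension:
  assumes C: "C \<in> Obj E" and X: "X \<in> Obj E" and a: "a \<in> hom E (Prod E C X) (Omega E)"
  shows "curry_arr E C X a \<in> hom E X (Pow_obj E C)"
    and "\<lbrakk>c \<in> hom E Y C; h \<in> hom E Y X\<rbrakk>
      \<Longrightarrow> member C c (curry_arr E C X a \<cdot> h) \<longleftrightarrow> a \<cdot> pair E c h = truth_on E Y"
  using curry_hom_ev[OF C X a] ev_curry[OF C X a]
  by (simp_all add: Pow_obj_def member_def homD(2))

section \<open>Meets and the order of power objects\<close>

lemma meet_arrow:
  assumes C: "C \<in> Obj E"
  shows "and_Pow E C \<in> hom E (Prod E (Pow_obj E C) (Pow_obj E C)) (Pow_obj E C)"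
    and "\<lbrakk>s \<in> hom E X (Pow_obj E C); t \<in> hom E X (Pow_obj E C); c \<in> hom E X C\<rbrakk>
      \<Longrightarrow> member C c (meet E C s t) \<longleftrightarrow> member C c s \<and> member C c t"
proof -
  let ?P = "Pow_obj E C" and ?ev = "Ev E C (Omega E)"
  note P = pow_obj[OF C]
  note ev = ev_hom[OF C omega_obj, folded Pow_obj_def]
  note i = ident_hom[OF C]
  note p1 = fst_hom[OF P P] and p2 = snd_hom[OF P P]
  note f = compose_hom[OF cross_hom[OF i p1] ev] and g = compose_hom[OF cross_hom[OF i p2] ev]
  note fg = pair_hom[OF f g]
  let ?fg = "pair E (?ev \<cdot> cross E (Ident E C) (Fst E ?P ?P))
    (?ev \<cdot> cross E (Ident E C) (Snd E ?P ?P))"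
  note a = compose_hom[OF fg and_Omega_hom]
  have def: "and_Pow E C = curry_arr E C (Prod E ?P ?P) (and_Omega E \<cdot> ?fg)"
    by (simp add: and_Pow_def Let_def)
  show "and_Pow E C \<in> hom E (Prod E ?P ?P) ?P"
    unfolding def by (rule comprehension(1)[OF C prod_obj[OF P P] a])
  assume s: "s \<in> hom E X ?P" and t: "t \<in> hom E X ?P" and c: "c \<in> hom E X C"
  note st = pair_hom[OF s t]
  note cs = compose_hom[OF pair_hom[OF c s] ev] and ct = compose_hom[OF pair_hom[OF c t] ev]
  have "?fg \<cdot> pair E c (pair E s t) = pair E (?ev \<cdot> pair E c s) (?ev \<cdot> pair E c t)"
    unfolding pair_compose[OF f g pair_hom[OF c st]]
      ev_cross_pair[OF p1[unfolded Pow_obj_def] C omega_obj c st[unfolded Pow_obj_def],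
        folded Pow_obj_def]
      ev_cross_pair[OF p2[unfolded Pow_obj_def] C omega_obj c st[unfolded Pow_obj_def],
        folded Pow_obj_def]
      fst_pair[OF s t] snd_pair[OF s t] ..
  then show "member C c (meet E C s t) \<longleftrightarrow> member C c s \<and> member C c t"
    unfolding meet_def def comprehension(2)[OF C prod_obj[OF P P] a c st]
      compose_assoc[OF pair_hom[OF c st] fg and_Omega_hom]
    using and_true_iff[OF cs ct] by (simp add: member_def homD(2)[OF c])
qed

lemmas and_Pow_hom = meet_arrow(1)
lemmas member_meet = meet_arrow(2)

lemma meet_hom:
  assumes C: "C \<in> Obj E"
    and s: "s \<in> hom E X (Pow_obj E C)" and t: "t \<in> hom E X (Pow_obj E C)"
  shows "meet E C s t \<in> hom E X (Pow_obj E C)"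
  unfolding meet_def by (rule compose_hom[OF pair_hom[OF s t] and_Pow_hom[OF C]])

lemma meet_compose:
  assumes C: "C \<in> Obj E"
    and s: "s \<in> hom E X (Pow_obj E C)" and t: "t \<in> hom E X (Pow_obj E C)"
    and h: "h \<in> hom E Y X"
  shows "meet E C s t \<cdot> h = meet E C (s \<cdot> h) (t \<cdot> h)"
  unfolding meet_def
  using compose_assoc[OF h pair_hom[OF s t] and_Pow_hom[OF C]] pair_compose[OF s t h] by simp

lemma meet_eq_iff:
  assumes C: "C \<in> Obj E" and s: "s \<in> hom E X (Pow_obj E C)"
    and t: "t \<in> hom E X (Pow_obj E C)" and v: "v \<in> hom E X (Pow_obj E C)"
  shows "meet E C s t = v \<longleftrightarrow> (\<forall>Y. \<forall>h\<in>hom E Y X. \<forall>c\<in>hom E Y C.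
    member C c (s \<cdot> h) \<and> member C c (t \<cdot> h) \<longleftrightarrow> member C c (v \<cdot> h))"
proof -
  have *: "member C c (meet E C s t \<cdot> h) \<longleftrightarrow> member C c (s \<cdot> h) \<and> member C c (t \<cdot> h)"
    if h: "h \<in> hom E Y X" and c: "c \<in> hom E Y C" for Y h c
    unfolding meet_compose[OF C s t h]
    by (rule member_meet[OF C compose_hom[OF h s] compose_hom[OF h t] c])
  show ?thesis
    using * pow_eqI[OF C meet_hom[OF C s t] v] by blast
qed

lemma le_Pow_equalizer:
  assumes C: "C \<in> Obj E"
  shows "is_equalizer E (and_Pow E C) (Fst E (Pow_obj E C) (Pow_obj E C)) (le_Pow E C)"
  unfolding le_Pow_def
  by (rule eq_equalizer[OF and_Pow_hom[OF C] fst_hom[OF pow_obj[OF C] pow_obj[OF C]]])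

lemma le_Pow_hom_monic:
  assumes C: "C \<in> Obj E"
  shows "le_Pow E C \<in> hom E (Dom E (le_Pow E C)) (Prod E (Pow_obj E C) (Pow_obj E C))"
    and "monic E (le_Pow E C)"
proof -
  note eq = le_Pow_equalizer[OF C] and a = and_Pow_hom[OF C]
  show "le_Pow E C \<in> hom E (Dom E (le_Pow E C)) (Prod E (Pow_obj E C) (Pow_obj E C))"
    using eq homD(2)[OF a] by (simp add: is_equalizer_def)
  show "monic E (le_Pow E C)"
    by (rule monic_equalizer[OF eq a fst_hom[OF pow_obj[OF C] pow_obj[OF C]]])
qed

text \<open>The pair \<open>\<langle>s, t\<rangle>\<close> factors through the equalizer \<open>(\<le>)\<close> precisely if \<open>\<and>\<close> and the first projection
  agree on it.\<close>

lemma imp_true_iff_meet: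
  assumes C: "C \<in> Obj E"
    and s: "s \<in> hom E X (Pow_obj E C)" and t: "t \<in> hom E X (Pow_obj E C)"
  shows "imp E C s t = truth_on E X \<longleftrightarrow> meet E C s t = s"
proof -
  let ?P = "Pow_obj E C" and ?m = "le_Pow E C"
  note a = and_Pow_hom[OF C] and p = fst_hom[OF pow_obj[OF C] pow_obj[OF C]]
  note m = le_Pow_hom_monic(1)[OF C] and eq = le_Pow_equalizer[OF C]
  note st = pair_hom[OF s t]
  have "imp E C s t = truth_on E X \<longleftrightarrow> (\<exists>u\<in>hom E X (Dom E ?m). ?m \<cdot> u = pair E s t)"
    unfolding imp_def by (rule char_arr_true_iff[OF m le_Pow_hom_monic(2)[OF C] st])
  also have "\<dots> \<longleftrightarrow> and_Pow E C \<cdot> pair E s t = Fst E ?P ?P \<cdot> pair E s t"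
  proof
    assume "\<exists>u\<in>hom E X (Dom E ?m). ?m \<cdot> u = pair E s t"
    then obtain u where u: "u \<in> hom E X (Dom E ?m)" "?m \<cdot> u = pair E s t" by blast
    then show "and_Pow E C \<cdot> pair E s t = Fst E ?P ?P \<cdot> pair E s t"
      using compose_assoc[OF u(1) m a] compose_assoc[OF u(1) m p] eq
      unfolding is_equalizer_def by metis
  next
    assume "and_Pow E C \<cdot> pair E s t = Fst E ?P ?P \<cdot> pair E s t"
    then show "\<exists>u\<in>hom E X (Dom E ?m). ?m \<cdot> u = pair E s t"
      using eq st unfolding is_equalizer_def homD(2)[OF a] by blast
  qed
  finally show ?thesis unfolding meet_def fst_pair[OF s t] .
qed

lemma imp_true_iff:
  assumes C: "C \<in> Obj E"
    and s: "s \<in> hom E X (Pow_obj E C)" and t: "t \<in> hom E X (Pow_obj E C)"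
  shows "imp E C s t = truth_on E X \<longleftrightarrow>
    (\<forall>Y. \<forall>h\<in>hom E Y X. \<forall>c\<in>hom E Y C. member C c (s \<cdot> h) \<longrightarrow> member C c (t \<cdot> h))"
  unfolding imp_true_iff_meet[OF C s t] meet_eq_iff[OF C s t s] by blast

lemma imp_compose:
  assumes C: "C \<in> Obj E"
    and s: "s \<in> hom E X (Pow_obj E C)" and t: "t \<in> hom E X (Pow_obj E C)"
    and h: "h \<in> hom E Y X"
  shows "imp E C s t \<cdot> h = imp E C (s \<cdot> h) (t \<cdot> h)"
  unfolding imp_def
  using compose_assoc[OF h pair_hom[OF s t] char_arr_hom[OF le_Pow_hom_monic[OF C]]]
    pair_compose[OF s t h] by simp

lemma imp_antisym:
  assumes C: "C \<in> Obj E"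
    and s: "s \<in> hom E X (Pow_obj E C)" and t: "t \<in> hom E X (Pow_obj E C)"
    and "imp E C s t = truth_on E X" and "imp E C t s = truth_on E X"
  shows "s = t"
  using assms(4,5) unfolding imp_true_iff[OF C s t] imp_true_iff[OF C t s]
  by (intro pow_eqI[OF C s t]) blast

lemma prop_on_hom: "\<lbrakk>p \<in> propositions E C; X \<in> Obj E\<rbrakk> \<Longrightarrow> prop_on E p X \<in> hom E X (Pow_obj E C)"
  unfolding propositions_def prop_on_def by (rule compose_hom[OF bang_hom])

lemma prop_on_compose:
  assumes p: "p \<in> propositions E C" and h: "h \<in> hom E Y X"
  shows "prop_on E p X \<cdot> h = prop_on E p Y"
  unfolding prop_on_def
  using compose_assoc[OF h bang_hom[OF homD(5)[OF h]] p[unfolded propositions_def]]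
    bang_compose[OF h] by simp

lemma prop_on_one: "p \<in> propositions E C \<Longrightarrow> prop_on E p (One E) = p"
  unfolding prop_on_def bang_one propositions_def by (rule compose_ident)

section \<open>Bottom and pseudocomplements of power objects\<close>

text \<open>The transpose of the constant map false on \<open>C \<times> 1\<close> is a least element, because at an initial stage
  every membership statement holds; antisymmetry of the order makes it the only one.\<close>

lemma bot_Pow_spec:
  assumes C: "C \<in> Obj E"
  shows "bot_Pow E C \<in> propositions E C"
    and "c \<in> hom E Y C \<Longrightarrow> member C c (prop_on E (bot_Pow E C) Y) \<longleftrightarrow> initial E Y"
proof -
  note C1 = prod_obj[OF C one_obj]
  define b where "b = curry_arr E C (One E) (false_Omega E \<cdot> bang E (Prod E C (One E)))"
  note a = compose_hom[OF bang_hom[OF C1] false_Omega_hom]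
  have b: "b \<in> propositions E C"
    unfolding b_def propositions_def by (rule comprehension(1)[OF C one_obj a])
  have mem: "member C c (prop_on E b Y) \<longleftrightarrow> initial E Y" if c: "c \<in> hom E Y C" for c Y
  proof -
    note Y = homD(4)[OF c]
    show ?thesis
      unfolding prop_on_def b_def comprehension(2)[OF C one_obj a c bang_hom[OF Y]]
        false_on_compose[OF pair_hom[OF c bang_hom[OF Y]]] by (rule false_true_iff[OF Y])
  qed
  have bot: "imp E C (prop_on E b X) t = truth_on E X" if t: "t \<in> hom E X (Pow_obj E C)" for X t
  proof -
    show ?thesis
      unfolding imp_true_iff[OF C prop_on_hom[OF b homD(4)[OF t]] t]
      using prop_on_compose[OF b] mem member_if_initial[OF _ compose_hom[OF _ t]] by metis
  qed
  have "bot_Pow E C = b"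
    unfolding bot_Pow_def
  proof (rule the_equality, intro conjI allI ballI)
    fix b' assume b': "b' \<in> propositions E C \<and> (\<forall>X. \<forall>t\<in>hom E X (Pow_obj E C).
      imp E C (prop_on E b' X) t = truth_on E X)"
    then have "prop_on E b' (One E) = b'" "prop_on E b (One E) = b"
      using prop_on_one b by blast+
    then show "b' = b"
      using imp_antisym[OF C] b b' bot[of b' "One E"] unfolding propositions_def by metis
  qed (use b bot in auto)
  with b mem show "bot_Pow E C \<in> propositions E C"
    and "c \<in> hom E Y C \<Longrightarrow> member C c (prop_on E (bot_Pow E C) Y) \<longleftrightarrow> initial E Y"
    by simp_all
qed

lemma meet_eq_bot_iff:
  assumes C: "C \<in> Obj E"
    and s: "s \<in> hom E X (Pow_obj E C)" and t: "t \<in> hom E X (Pow_obj E C)"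
  shows "meet E C s t = prop_on E (bot_Pow E C) X \<longleftrightarrow> (\<forall>Y. \<forall>h\<in>hom E Y X. \<forall>c\<in>hom E Y C.
    member C c (s \<cdot> h) \<and> member C c (t \<cdot> h) \<longrightarrow> initial E Y)"
proof -
  note b = bot_Pow_spec(1)[OF C]
  note mem = member_if_initial[OF _ compose_hom]
  show ?thesis
    unfolding meet_eq_iff[OF C s t prop_on_hom[OF b homD(4)[OF s]]]
    using mem[OF _ _ s] mem[OF _ _ t] prop_on_compose[OF b] bot_Pow_spec(2)[OF C] by metis
qed

text \<open>The transpose of \<open>(c, \<star>) \<mapsto> \<not> (c \<in> p)\<close> is a pseudocomplement. Both sides of its adjunction say
  that stages at which something belongs to both \<open>t\<close> and \<open>p\<close> are initial, the left side after a
  further change of stage that does not matter because membership is stable. Uniqueness holds as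
  two pseudocomplements have the same lower bounds and so lie below each other.\<close>

lemma neg_Pow_spec:
  assumes C: "C \<in> Obj E" and p: "p \<in> propositions E C"
  shows "neg_Pow E C p \<in> propositions E C"
    and "t \<in> hom E X (Pow_obj E C) \<Longrightarrow>
      imp E C t (prop_on E (neg_Pow E C p) X) = truth_on E X \<longleftrightarrow>
      meet E C t (prop_on E p X) = prop_on E (bot_Pow E C) X"
proof -
  note i = ident_hom[OF C] and ev = ev_hom[OF C omega_obj]
  note p' = p[unfolded propositions_def Pow_obj_def]
  let ?p = "Ev E C (Omega E) \<cdot> cross E (Ident E C) p"
  note a = compose_hom[OF cross_hom[OF i p'] ev]
  note na = compose_hom[OF a not_Omega_hom]
  define n where "n = curry_arr E C (One E) (not_Omega E \<cdot> ?p)"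
  have n: "n \<in> propositions E C"
    unfolding n_def propositions_def by (rule comprehension(1)[OF C one_obj na])
  have mem: "member C c (prop_on E n Y) \<longleftrightarrow>
      (\<forall>Z. \<forall>k\<in>hom E Z Y. member C (c \<cdot> k) (prop_on E p Z) \<longrightarrow> initial E Z)"
    if c: "c \<in> hom E Y C" for c Y
  proof -
    note Y = homD(4)[OF c]
    note cy = pair_hom[OF c bang_hom[OF Y]]
    have "(?p \<cdot> pair E c (bang E Y)) \<cdot> k = truth_on E Z \<longleftrightarrow> member C (c \<cdot> k) (prop_on E p Z)"
      if k: "k \<in> hom E Z Y" for k Z
      unfolding compose_assoc[OF k cy a] pair_compose[OF c bang_hom[OF Y] k] bang_compose[OF k]
        ev_cross_pair[OF p' C omega_obj compose_hom[OF k c] bang_hom[OF homD(4)[OF k]]]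
      by (simp add: member_def prop_on_def homD(2)[OF compose_hom[OF k c]])
    then show ?thesis
      unfolding prop_on_def[of _ n] unfolding n_def comprehension(2)[OF C one_obj na c bang_hom[OF Y]]
        compose_assoc[OF cy a not_Omega_hom] not_true_iff[OF compose_hom[OF cy a]]
      by blast
  qed
  have neg: "imp E C t (prop_on E n X) = truth_on E X \<longleftrightarrow>
      meet E C t (prop_on E p X) = prop_on E (bot_Pow E C) X"
    if t: "t \<in> hom E X (Pow_obj E C)" for X t
  proof -
    note X = homD(4)[OF t]
    have "imp E C t (prop_on E n X) = truth_on E X \<longleftrightarrow>
      (\<forall>Y. \<forall>h\<in>hom E Y X. \<forall>c\<in>hom E Y C. member C c (t \<cdot> h) \<longrightarrow>
        (\<forall>Z. \<forall>k\<in>hom E Z Y. member C (c \<cdot> k) (prop_on E p Z) \<longrightarrow> initial E Z))"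
      unfolding imp_true_iff[OF C t prop_on_hom[OF n X]]
      by (simp add: prop_on_compose[OF n] mem)
    also have "\<dots> \<longleftrightarrow> (\<forall>Y. \<forall>h\<in>hom E Y X. \<forall>c\<in>hom E Y C.
        member C c (t \<cdot> h) \<and> member C c (prop_on E p Y) \<longrightarrow> initial E Y)" (is "?L \<longleftrightarrow> ?R")
    proof
      assume ?L
      show ?R
      proof (intro allI ballI impI)
        fix Y h c assume h: "h \<in> hom E Y X" and c: "c \<in> hom E Y C"
          and "member C c (t \<cdot> h) \<and> member C c (prop_on E p Y)"
        with \<open>?L\<close> ident_hom[OF homD(4)[OF h]] show "initial E Y"
          using compose_ident[OF c] by metis
      qed
    next
      assume R: ?R
      show ?L
      proof (intro allI ballI impI)
        fix Y h c Z k assume h: "h \<in> hom E Y X" and c: "c \<in> hom E Y C"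
          and k: "k \<in> hom E Z Y" and mt: "member C c (t \<cdot> h)"
          and mp: "member C (c \<cdot> k) (prop_on E p Z)"
        have "member C (c \<cdot> k) (t \<cdot> (h \<cdot> k))"
          using member_compose[OF compose_hom[OF h t] c k mt] compose_assoc[OF k h t] by simp
        with R mp compose_hom[OF k h] compose_hom[OF k c] show "initial E Z" by blast
      qed
    qed
    also have "\<dots> \<longleftrightarrow> meet E C t (prop_on E p X) = prop_on E (bot_Pow E C) X"
      unfolding meet_eq_bot_iff[OF C t prop_on_hom[OF p X]]
      by (simp add: prop_on_compose[OF p])
    finally show ?thesis .
  qed
  have "neg_Pow E C p = n"
    unfolding neg_Pow_def
  proof (rule the_equality, intro conjI allI ballI)
    fix n' assume n': "n' \<in> propositions E C \<and> (\<forall>X. \<forall>t\<in>hom E X (Pow_obj E C).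
      imp E C t (prop_on E n' X) = truth_on E X \<longleftrightarrow>
      meet E C t (prop_on E p X) = prop_on E (bot_Pow E C) X)"
    have nh: "n \<in> hom E (One E) (Pow_obj E C)" "n' \<in> hom E (One E) (Pow_obj E C)"
      using n n' by (simp_all add: propositions_def)
    have one: "prop_on E n (One E) = n" "prop_on E n' (One E) = n'"
      using n n' prop_on_one by blast+
    have iff: "imp E C t n' = truth_on E (One E) \<longleftrightarrow> imp E C t n = truth_on E (One E)"
      if t: "t \<in> hom E (One E) (Pow_obj E C)" for t
      using n'[THEN conjunct2, rule_format, OF t] neg[OF t] one by simp
    have "imp E C n n = truth_on E (One E)" "imp E C n' n' = truth_on E (One E)"
      using imp_true_iff[OF C] nh by blast+
    then show "n' = n"
      using iff[OF nh(1)] iff[OF nh(2)] by (intro imp_antisym[OF C nh(2,1)]) simp_all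
  qed (use n neg in auto)
  with n neg show "neg_Pow E C p \<in> propositions E C"
    and "t \<in> hom E X (Pow_obj E C) \<Longrightarrow>
      imp E C t (prop_on E (neg_Pow E C p) X) = truth_on E X \<longleftrightarrow>
      meet E C t (prop_on E p X) = prop_on E (bot_Pow E C) X"
    by simp_all
qed

text \<open>At a stage over \<open>X\<close> where something belongs to both \<open>s\<close> and \<open>p\<close>, it also belongs to \<open>q\<close> and hence
  to \<open>p \<and> q = \<bottom>\<close>, so the stage is initial.\<close>

lemma disjoint_imp_neg:
  assumes C: "C \<in> Obj E" and p: "p \<in> propositions E C" and q: "q \<in> propositions E C"
    and disj: "meet E C p q = bot_Pow E C" and s: "s \<in> hom E X (Pow_obj E C)"
    and sq: "imp E C s (prop_on E q X) = truth_on E X"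
  shows "imp E C s (prop_on E (neg_Pow E C p) X) = truth_on E X"
proof -
  note X = homD(4)[OF s]
  note pX = prop_on_hom[OF p X] and qX = prop_on_hom[OF q X]
  have "meet E C (prop_on E p X) (prop_on E q X) = prop_on E (bot_Pow E C) X"
    using meet_compose[OF C _ _ bang_hom[OF X]] p q disj
    unfolding propositions_def prop_on_def by metis
  then show ?thesis
    using sq
    unfolding neg_Pow_spec(2)[OF C p s] meet_eq_bot_iff[OF C s pX] meet_eq_bot_iff[OF C pX qX]
      imp_true_iff[OF C s qX] by blast
qed

section \<open>Inconsistent stages\<close>

lemma not_truth_on_imp_initial:
  assumes X: "X \<in> Obj E" and "not_Omega E \<cdot> truth_on E X = truth_on E X"
  shows "initial E X"
  using assms(2) ident_hom[OF X] compose_ident[OF truth_on_hom[OF X]]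
  unfolding not_true_iff[OF truth_on_hom[OF X]] by blast

text \<open>True and false on \<open>W\<close> agree after composition with \<open>r\<close>, because there is only one arrow from \<open>X\<close> to
  \<open>\<Omega>\<close>. Cancelling \<open>r\<close>, true is false on \<open>W\<close>.\<close>

lemma initial_epic:
  assumes X: "initial E X" and r: "r \<in> hom E X W" and epi: "epic E r"
  shows "initial E W"
proof -
  note W = homD(5)[OF r]
  note t = truth_on_hom[OF W] and f = compose_hom[OF bang_hom[OF W] false_Omega_hom]
  have "truth_on E W \<cdot> r = (false_Omega E \<cdot> bang E W) \<cdot> r"
    by (rule initial_arrow_eq[OF X compose_hom[OF r t] compose_hom[OF r f]])
  then have "truth_on E W = false_Omega E \<cdot> bang E W"
    using epi t f unfolding epic_def homD(3)[OF r] by blast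
  then show ?thesis using false_true_iff[OF W] by simp
qed

end

section \<open>Safe propositions along executions\<close>

context estimate_consensus_protocol
begin

lemma estimate_hom: "e0 \<in> hom E (obs \<Sigma>) (Pow_obj E C)"
  using estimate_functor by (simp add: internal_functor_def Pow_icat_def Let_def)

text \<open>Since \<open>d\<^sub>0 f = w r\<close>, an execution factors through the pullback \<open>\<Sigma>(w, -)\<close>, and the truth of the
  implication there restricts along this factorization.\<close>

lemma safe_execution:
  assumes w: "w \<in> hom E W (obs \<Sigma>)" and p: "p \<in> propositions E C"
    and safe: "safe E C \<Sigma> e0 w p"
    and exec: "execution E \<Sigma> f r w v" and v: "v \<in> hom E X (obs \<Sigma>)"
  shows "imp E C (e0 \<cdot> v) (prop_on E p X) = truth_on E X"
proof -
  let ?S = "pb_obj E w (d0 \<Sigma>)" and ?f = "pb2 E w (d0 \<Sigma>)"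
  have f: "f \<in> hom E (Dom E f) (arrs \<Sigma>)" and r: "r \<in> hom E (Dom E f) W"
    and eq: "w \<cdot> r = d0 \<Sigma> \<cdot> f" and v_def: "v = d1 \<Sigma> \<cdot> f"
    using exec homD(2)[OF w] by (auto simp: execution_def)
  have X: "Dom E f = X"
    using v homD(2)[OF v] homD(2)[OF compose_hom[OF f d1_hom]] by (simp add: v_def)
  note f = f[unfolded X] and r = r[unfolded X]
  note \<pi> = pullback_universal(1)[OF w d0_hom]
  obtain u where u: "u \<in> hom E X ?S" "?f \<cdot> u = f"
    using pullback_universal(2)[OF w d0_hom r f eq] by blast
  note d = compose_hom[OF \<pi> d1_hom]
  have "imp E C (e0 \<cdot> d1 \<Sigma> \<cdot> ?f) (prop_on E p ?S) \<cdot> u = truth_on E X"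
    using safe truth_on_compose[OF u(1)] by (simp add: safe_def)
  then show ?thesis
    using imp_compose[OF consensus_obj compose_hom[OF d estimate_hom]
        prop_on_hom[OF p homD(4)[OF \<pi>]] u(1)]
      compose_assoc[OF u(1) d estimate_hom] compose_assoc[OF u(1) \<pi> d1_hom]
      prop_on_compose[OF p u(1)] u(2) by (simp add: v_def)
qed

end

theorem theorem8p7:
  fixes E :: "('o, 'a) topos_data" and C :: 'o and \<Sigma> :: "('o, 'a) icat" and e0 e1 :: 'a
    and p q w1 w2 :: 'a and W1 W2 :: 'o
  assumes "estimate_consensus_protocol E C \<Sigma> e0 e1"
    and "p \<in> propositions E C" and "q \<in> propositions E C"
    and "meet E C p q = bot_Pow E C"
    and "w1 \<in> hom E W1 (obs \<Sigma>)" and "w2 \<in> hom E W2 (obs \<Sigma>)"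
    and "compatible E \<Sigma> w1 w2"
    and "\<not> initial E W1"
  shows "\<not> (safe E C \<Sigma> e0 w1 p \<and> safe E C \<Sigma> e0 w2 q)"
proof
  interpret estimate_consensus_protocol E C \<Sigma> e0 e1 by (rule assms(1))
  assume safe: "safe E C \<Sigma> e0 w1 p \<and> safe E C \<Sigma> e0 w2 q"
  obtain X w3 f1 r1 f2 r2 where w3: "w3 \<in> hom E X (obs \<Sigma>)"
    and ex1: "execution E \<Sigma> f1 r1 w1 w3" and ex2: "execution E \<Sigma> f2 r2 w2 w3"
    using assms(7) by (auto simp: compatible_def)
  note X = homD(4)[OF w3]
  have p: "imp E C (e0 \<cdot>\<^bsub>E\<^esub> w3) (prop_on E p X) = truth_on E X"
    using safe_execution[OF assms(5,2) _ ex1 w3] safe by blast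
  have q: "imp E C (e0 \<cdot>\<^bsub>E\<^esub> w3) (prop_on E q X) = truth_on E X"
    using safe_execution[OF assms(6,3) _ ex2 w3] safe by blast
  have "imp E C (e0 \<cdot>\<^bsub>E\<^esub> w3) (prop_on E (neg_Pow E C p) X) = truth_on E X"
    by (rule disjoint_imp_neg[OF consensus_obj assms(2-4) compose_hom[OF w3 estimate_hom] q])
  with estimate_consistent[OF w3 assms(2) p] have "initial E X"
    by (intro not_truth_on_imp_initial[OF X]) simp
  moreover have "epic E r1" "r1 \<in> hom E X W1"
    using ex1 homD(2)[OF assms(5)] homD(2)[OF w3] homD(2)[OF compose_hom[OF _ d1_hom]]
    by (auto simp: execution_def)
  ultimately have "initial E W1" using initial_epic by blast
  with assms(8) show False by blast
qed

end
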